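(* Let $x,y$ be integers with $1<x<y$, and let $a,b,c\ge 0$ be integers with $c\equiv 0$ or $1\pmod y$. If $a+b=y-1$ and $a\ge \omega(x,b)$, then the multiset $\{1^a,x^b,y^c\}$ has a standard linear realization.
   Context: For a positive integer $n$, $K_n$ is the complete graph on vertex set $\{0,\dots,n-1\}$ and the linear length of an edge $\{u,w\}$ is $|u-w|$. A multiset $M$ of positive integers of size $n-1$ has a linear realization if some Hamiltonian path in $K_n$ has multiset of linear edge lengths equal to $M$; the realization is standard if the path starts at vertex $0$. $\{x_1^{a_1},\dots\}$ denotes the multiset with $x_i$ of multiplicity $a_i$. For integers $z\ge2$ and $d\ge 0$, $\omega(z,d)$ denotes the smallest integer $a\ge0$ such that $\{1^a,z^d\}$ has a standard linear realization (this minimum exists). *)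

theory Defs
  imports "HOL-Library.Multiset" "HOL-Number_Theory.Cong"
begin

definition complete_edges :: "nat \<Rightarrow> nat set set" where
  "complete_edges n = {{u, w} | u w. u < n \<and> w < n \<and> u \<noteq> w}"

text \<open>A path is the list of the vertices it visits, in order.\<close>

definition hamiltonian_path :: "'v set \<Rightarrow> 'v set set \<Rightarrow> 'v list \<Rightarrow> bool" where
  "hamiltonian_path V E p \<longleftrightarrow>
     set p = V \<and> distinct p \<and> successively (\<lambda>u w. {u, w} \<in> E) p"

definition linear_length :: "nat \<Rightarrow> nat \<Rightarrow> nat" where
  "linear_length u w = nat \<bar>int u - int w\<bar>"

text \<open>\<open>map2\<close> stops at the end of the shorter list \<open>tl p\<close>, so it runs over
  exactly the pairs of consecutive vertices of \<open>p\<close>.\<close>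

definition edge_lengths :: "nat list \<Rightarrow> nat multiset" where
  "edge_lengths p = mset (map2 linear_length p (tl p))"

text \<open>A multiset of size \<open>n - 1\<close> is realized in the complete graph on \<open>{0..<n}\<close>,
  i.e. \<open>n = size M + 1\<close>. A multiset containing \<open>0\<close> has no realization, since
  every edge has positive length.\<close>

definition linear_realization :: "nat multiset \<Rightarrow> nat list \<Rightarrow> bool" where
  "linear_realization M p \<longleftrightarrow>
     hamiltonian_path {0..<size M + 1} (complete_edges (size M + 1)) p \<and> edge_lengths p = M"

definition standard_linear_realization :: "nat multiset \<Rightarrow> nat list \<Rightarrow> bool" where
  "standard_linear_realization M p \<longleftrightarrow> linear_realization M p \<and> hd p = 0"

definition omega :: "nat \<Rightarrow> nat \<Rightarrow> nat" where
  "omega z d =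
     (LEAST a. \<exists>p. standard_linear_realization (replicate_mset a 1 + replicate_mset d z) p)"

end

theory Submission
  imports Defs
begin

text \<open>A standard realization \<open>p\<close> of \<open>{1\<^sup>a, x\<^sup>b}\<close> visits every residue class modulo
  \<open>y = a + b + 1\<close> once. Arrange \<open>0, \<dots>, (k + 1) y - 1\<close> in \<open>y\<close> columns, one for each residue,
  and traverse them in the order given by \<open>p\<close>, alternately upwards and downwards: each column
  contributes \<open>k\<close> edges of length \<open>y\<close>, and the passages between the columns repeat the edges of
  \<open>p\<close>. Starting upwards gives \<open>c = k y\<close>. For \<open>c = k y + 1\<close>, start downwards, reflect the
  path onto \<open>1, \<dots>, (k + 1) y\<close>, so that it begins at \<open>y\<close>, and put \<open>0\<close> in front.\<close>

section \<open>Edge-length multisets, and gluing of standard realizations\<close>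

lemma replicate_mset_plus: "replicate_mset (m + n) u = replicate_mset m u + replicate_mset n u"
  by (induction m) simp_all

lemma linear_length_commute: "linear_length u w = linear_length w u"
  by (simp add: linear_length_def)

lemma linear_length_add_left [simp]: "linear_length (m + u) (m + w) = linear_length u w"
  by (simp add: linear_length_def)

lemma linear_length_add_right [simp]: "linear_length (u + m) (w + m) = linear_length u w"
  by (simp add: linear_length_def)

lemma linear_length_add_self [simp]:
  "linear_length u (u + m) = m" "linear_length (u + m) u = m" "linear_length 0 m = m"
  by (simp_all add: linear_length_def)

lemma linear_length_reflect:
  "u \<le> N \<Longrightarrow> w \<le> N \<Longrightarrow> linear_length (N - u) (N - w) = linear_length u w"
  by (simp add: linear_length_def)

lemma edge_lengths_Nil [simp]: "edge_lengths [] = {#}"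
  by (simp add: edge_lengths_def)

lemma edge_lengths_singleton [simp]: "edge_lengths [u] = {#}"
  by (simp add: edge_lengths_def)

lemma edge_lengths_Cons:
  "p \<noteq> [] \<Longrightarrow> edge_lengths (u # p) = add_mset (linear_length u (hd p)) (edge_lengths p)"
  by (cases p) (simp_all add: edge_lengths_def)

lemma edge_lengths_append:
  assumes "p \<noteq> []" "q \<noteq> []"
  shows "edge_lengths (p @ q) =
    add_mset (linear_length (last p) (hd q)) (edge_lengths p + edge_lengths q)"
  using assms(1)
proof (induction p rule: list_nonempty_induct)
  case (single u)
  then show ?case using assms(2) by (simp add: edge_lengths_Cons)
next
  case (cons u p)
  then show ?case by (simp add: edge_lengths_Cons)
qed

lemma edge_lengths_rev [simp]: "edge_lengths (rev p) = edge_lengths p"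
proof (induction p)
  case (Cons u p)
  then show ?case
    by (cases "p = []")
      (simp_all add: edge_lengths_append edge_lengths_Cons last_rev linear_length_commute)
qed simp

lemma edge_lengths_map:
  assumes "\<And>u w. u \<in> set p \<Longrightarrow> w \<in> set p \<Longrightarrow> linear_length (f u) (f w) = linear_length u w"
  shows "edge_lengths (map f p) = edge_lengths p"
  using assms
proof (induction p)
  case (Cons u p)
  then show ?case by (cases "p = []") (simp_all add: edge_lengths_Cons hd_map)
qed simp

lemma size_edge_lengths: "size (edge_lengths p) = length p - 1"
  by (simp add: edge_lengths_def)

text \<open>Distinct vertices of a complete graph are always adjacent, so the adjacency condition is
  automatic, and the size of \<open>M\<close> is forced by the number of edges. Nonemptiness is
  stated separately because \<open>[]\<close> has the same edge lengths as \<open>[0]\<close> and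
  \<open>hd []\<close> is unspecified.\<close>

lemma standard_linear_realization_iff:
  "standard_linear_realization M p \<longleftrightarrow>
    p \<noteq> [] \<and> distinct p \<and> set p = {0..<length p} \<and> edge_lengths p = M \<and> hd p = 0"
proof -
  \<comment> \<open>Inclusion instead of equality of vertex sets lets the induction pass to the
    tail.\<close>
  have "successively (\<lambda>u w. {u, w} \<in> complete_edges n) p"
    if "distinct p" "set p \<subseteq> {0..<n}" for n and p :: "nat list"
    using that
  proof (induction p)
    case (Cons u p)
    then show ?case
      by (cases p) (auto simp: complete_edges_def)
  qed simp
  moreover have "set p = {0..<size M + 1} \<Longrightarrow> p \<noteq> []"
    by auto
  moreover have "length p = n" if "distinct p" "set p = {0..<n}" for n
    using distinct_card[OF that(1)] that(2) by simp
  moreover have "size M + 1 = length p" if "p \<noteq> []" "edge_lengths p = M"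
    using size_edge_lengths[of p] that by (cases p) auto
  ultimately show ?thesis
    unfolding standard_linear_realization_def linear_realization_def hamiltonian_path_def
    by (metis order_refl)
qed

text \<open>Translation preserves lengths, and the shifted copy of \<open>q\<close> starts at
  \<open>length p\<close>, the first vertex that \<open>p\<close> leaves free. The one new edge
  joins \<open>last p\<close> to it.\<close>

lemma standard_linear_realization_append_shift:
  assumes "standard_linear_realization M p" "standard_linear_realization N q"
  shows "standard_linear_realization (add_mset (length p - last p) (M + N))
    (p @ map ((+) (length p)) q)"
proof -
  have p: "p \<noteq> []" "distinct p" "set p = {0..<length p}" "edge_lengths p = M" "hd p = 0"
    and q: "q \<noteq> []" "distinct q" "set q = {0..<length q}" "edge_lengths q = N" "hd q = 0"
    using assms by (auto simp: standard_linear_realization_iff)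
  have "last p < length p"
    using p(1,3) last_in_set by fastforce
  then have "linear_length (last p) (length p) = length p - last p"
    by (simp add: linear_length_def)
  moreover have "set (p @ map ((+) (length p)) q) = {0..<length p + length q}"
    using p(3) q(3) by (simp add: image_add_atLeastLessThan ivl_disj_un add.commute)
  moreover have "distinct (p @ map ((+) (length p)) q)"
    using p(2,3) q(2) by (auto simp: distinct_map)
  ultimately show ?thesis
    using p q by (simp add: standard_linear_realization_iff edge_lengths_append
        edge_lengths_map hd_map)
qed

section \<open>Columns: arithmetic progressions as paths\<close>

definition column :: "nat \<Rightarrow> nat \<Rightarrow> nat \<Rightarrow> nat list" where
  "column k y v = map (\<lambda>i. v + i * y) [0..<Suc k]"

lemma column_simps [simp]:
  "column k y v \<noteq> []" "hd (column k y v) = v" "last (column k y v) = v + k * y"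
  "length (column k y v) = Suc k"
  by (simp_all add: column_def hd_map last_map del: upt_Suc)

lemma edge_lengths_column [simp]: "edge_lengths (column k y v) = replicate_mset k y"
proof (induction k)
  case (Suc k)
  have *: "column (Suc k) y v = column k y v @ [v + k * y + y]"
    by (simp add: column_def)
  show ?case
    unfolding * using Suc by (simp add: edge_lengths_append)
qed (simp add: column_def)

lemma distinct_column [simp]: "0 < y \<Longrightarrow> distinct (column k y v)"
  by (auto simp: column_def distinct_map inj_on_def simp del: upt_Suc)

section \<open>Padding with ones, and attainment of the minimum in \<open>omega\<close>\<close>

lemma standard_linear_realization_singleton: "standard_linear_realization {#} [0]"
  by (simp add: standard_linear_realization_iff)

text \<open>The path is 0, x, x - 1, ..., 1. It has x + 1 vertices and ends at 1, so gluing a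
  further path behind it costs an edge of length exactly x.\<close>

lemma standard_linear_realization_jump:
  assumes "0 < x"
  shows "standard_linear_realization (add_mset x (replicate_mset (x - 1) 1))
    (0 # rev (column (x - 1) 1 1))"
proof -
  have "column (x - 1) 1 1 = map Suc [0..<x]"
    using assms by (simp add: column_def del: upt_Suc)
  then have "set (column (x - 1) 1 1) = {1..<Suc x}"
    by (simp add: image_Suc_atLeastLessThan)
  then show ?thesis
    using assms
    by (auto simp: standard_linear_realization_iff edge_lengths_Cons hd_rev)
qed

text \<open>This makes the \<open>LEAST\<close> in \<open>omega\<close> meaningful. The induction
  goes in steps of two: a jump block in front brings one x inside it and a second x as the bridge to
  the remaining path.\<close>

lemma ex_standard_linear_realization_ones:
  assumes "0 < x"
  shows "\<exists>a p. standard_linear_realization (replicate_mset a 1 + replicate_mset d x) p"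
proof (induction d rule: induct_nat_012)
  case 0
  show ?case
    by (rule exI[of _ 0], rule exI[of _ "[0]"])
      (simp add: standard_linear_realization_singleton)
next
  case 1
  show ?case
    using standard_linear_realization_jump[OF assms] by (auto intro!: exI[of _ "x - 1"])
next
  case (ge2 d)
  then obtain a p
    where p: "standard_linear_realization (replicate_mset a 1 + replicate_mset d x) p"
    by blast
  have "standard_linear_realization
      (replicate_mset (x - 1 + a) 1 + replicate_mset (Suc (Suc d)) x)
      ((0 # rev (column (x - 1) 1 1)) @
        map ((+) (length (0 # rev (column (x - 1) 1 1)))) p)"
    using standard_linear_realization_append_shift[OF standard_linear_realization_jump[OF assms] p]
      assms
    by (cases x) (simp_all add: last_rev replicate_mset_plus ac_simps)
  then show ?case by blast
qed

text \<open>Gluing behind the one-vertex path \<open>[0]\<close> adds a single edge of length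
  1.\<close>

lemma standard_linear_realization_add_ones:
  assumes "standard_linear_realization M p"
  shows "\<exists>q. standard_linear_realization (replicate_mset m 1 + M) q"
proof (induction m)
  case 0
  show ?case using assms by auto
next
  case (Suc m)
  then obtain q where "standard_linear_realization (replicate_mset m 1 + M) q"
    by blast
  from standard_linear_realization_append_shift[OF standard_linear_realization_singleton this]
  show ?case by auto
qed

lemma ex_standard_linear_realization_if_omega_le:
  assumes "0 < x" "omega x b \<le> a"
  shows "\<exists>p. standard_linear_realization (replicate_mset a 1 + replicate_mset b x) p"
proof -
  obtain p where
    "standard_linear_realization (replicate_mset (omega x b) 1 + replicate_mset b x) p"
    unfolding omega_def
    using LeastI_ex[OF ex_standard_linear_realization_ones[OF assms(1), of b]] by blast
  from standard_linear_realization_add_ones[OF this, of "a - omega x b"] show ?thesis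
    using assms(2) by (simp flip: add.assoc replicate_mset_plus)
qed

section \<open>Snakes: traversing the columns in alternating directions\<close>

fun snake :: "bool \<Rightarrow> nat \<Rightarrow> nat \<Rightarrow> nat list \<Rightarrow> nat list" where
  "snake up k y [] = []"
| "snake up k y (v # p) =
    (if up then column k y v else rev (column k y v)) @ snake (\<not> up) k y p"

lemma snake_eq_Nil_iff [simp]: "snake up k y p = [] \<longleftrightarrow> p = []"
  by (cases p) simp_all

lemma hd_snake: "p \<noteq> [] \<Longrightarrow> hd (snake up k y p) = hd p + (if up then 0 else k * y)"
  by (cases p) (simp_all add: hd_rev)

lemma set_snake: "set (snake up k y p) = {v + i * y | v i. v \<in> set p \<and> i \<le> k}"
proof (induction p arbitrary: up)
  case (Cons v p)
  have "set (column k y v) = {v + i * y | i. i \<le> k}"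
    by (auto simp: column_def simp del: upt_Suc)
  then show ?case using Cons by auto
qed simp

lemma length_snake: "length (snake up k y p) = length p * Suc k"
  by (induction p arbitrary: up) simp_all

text \<open>Since the direction alternates, each passage joins two columns at the same height, both
  at the bottom or both shifted by \<open>k * y\<close>. Its length is therefore that of the
  corresponding edge of \<open>p\<close>, whatever the initial direction.\<close>

lemma edge_lengths_snake:
  "edge_lengths (snake up k y p) = edge_lengths p + replicate_mset (k * length p) y"
proof (induction p arbitrary: up)
  case (Cons v p)
  show ?case
  proof (cases "p = []")
    case False
    then show ?thesis
      by (simp add: Cons edge_lengths_append edge_lengths_Cons hd_snake last_rev
          replicate_mset_plus)
  qed simp
qed simp

lemma set_snake_atLeastLessThan:
  assumes "set p = {0..<y}"
  shows "set (snake up k y p) = {0..<y * Suc k}"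
proof (intro equalityI subsetI)
  fix u assume "u \<in> set (snake up k y p)"
  then obtain v i where *: "u = v + i * y" "v < y" "i \<le> k"
    using assms by (auto simp: set_snake)
  then have "u < Suc i * y" by simp
  also have "\<dots> \<le> Suc k * y"
    using * by (intro mult_le_mono1) simp
  finally show "u \<in> {0..<y * Suc k}" by (simp add: mult.commute)
next
  fix u assume "u \<in> {0..<y * Suc k}"
  then have u: "u < y * Suc k" by simp
  then have "0 < y" by (cases y) simp_all
  have "u = u mod y + (u div y) * y" by simp
  moreover have "u mod y \<in> set p"
    using assms \<open>0 < y\<close> by simp
  moreover have "u div y \<le> k"
    using u by (simp add: less_mult_imp_div_less mult.commute flip: less_Suc_eq_le)
  ultimately show "u \<in> set (snake up k y p)"
    unfolding set_snake by blast
qed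

text \<open>Counting: the list has \<open>y * Suc k\<close> entries and as many different values, so
  none repeats.\<close>

lemma distinct_snake:
  assumes "length p = y" "set p = {0..<y}"
  shows "distinct (snake up k y p)"
  by (rule card_distinct)
    (simp only: set_snake_atLeastLessThan[OF assms(2)] length_snake assms(1)
      card_atLeastLessThan diff_zero)

theorem theorem3p1:
  fixes x y a b c :: nat
  assumes "1 < x" and "x < y"
    and "[c = 0] (mod y) \<or> [c = 1] (mod y)"
    and "a + b = y - 1"
    and "a \<ge> omega x b"
  shows "\<exists>p. standard_linear_realization
           (replicate_mset a 1 + replicate_mset b x + replicate_mset c y) p"
proof -
  obtain p where
    p: "standard_linear_realization (replicate_mset a 1 + replicate_mset b x) p"
    using ex_standard_linear_realization_if_omega_le[of x b a] assms by auto
  then have p_simps: "p \<noteq> []" "hd p = 0" "set p = {0..<length p}"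
    "edge_lengths p = replicate_mset a 1 + replicate_mset b x"
    by (simp_all add: standard_linear_realization_iff)
  \<comment> \<open>There are a + b = y - 1 edges, so the vertices of \<open>p\<close> are exactly
    the residues modulo y.\<close>
  have "length p = y"
    using size_edge_lengths[of p] p_simps assms by (cases p) auto
  define k where "k = c div y"
  let ?S = "\<lambda>up. snake up k y p"
  let ?N = "y * Suc k"
  have S: "?S up \<noteq> []" "set (?S up) = {0..<?N}" "length (?S up) = ?N" "distinct (?S up)"
    "edge_lengths (?S up) = replicate_mset a 1 + replicate_mset b x + replicate_mset (k * y) y"
    for up
    using p_simps \<open>length p = y\<close>
    by (simp_all add: set_snake_atLeastLessThan length_snake distinct_snake edge_lengths_snake
        del: mult_Suc_right)
  \<comment> \<open>Here 1 is its own residue because y > 1.\<close>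
  have "c mod y = 0 \<or> c mod y = 1"
    using assms(1-3) by (auto simp: cong_def)
  then consider "c = k * y" | "c = Suc (k * y)"
    unfolding k_def by (metis add_0_right div_mult_mod_eq Suc_eq_plus1)
  then show ?thesis
  proof cases
    case 1
    \<comment> \<open>Going upwards first, the snake starts at \<open>hd p\<close>, which is
      0.\<close>
    have "standard_linear_realization
        (replicate_mset a 1 + replicate_mset b x + replicate_mset c y) (?S True)"
      unfolding standard_linear_realization_iff
      using S[of True] p_simps 1 by (simp add: hd_snake del: mult_Suc_right)
    then show ?thesis by blast
  next
    case 2
    \<comment> \<open>Reflecting by \<open>?N - u\<close> rather than \<open>?N - 1 - u\<close>
      leaves 0 free. The downward snake starts at \<open>k * y\<close>, whose image is y, so
      prepending 0 supplies the one missing edge of length y.\<close>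
    let ?T = "map (\<lambda>u. ?N - u) (?S False)"
    have "set ?T = {1..?N}"
    proof -
      have "(\<lambda>u. ?N - u) ` {0..<?N} = {1..?N}"
      proof (intro equalityI subsetI)
        fix u assume "u \<in> {1..?N}"
        then show "u \<in> (\<lambda>u. ?N - u) ` {0..<?N}"
          by (intro image_eqI[of _ _ "?N - u"]) auto
      qed auto
      then show ?thesis using S(2)[of False] by simp
    qed
    \<comment> \<open>All entries are below \<open>?N\<close>, so the subtraction is never truncated
      and the reflection is an injective isometry on them.\<close>
    moreover have "distinct ?T"
      using S(2,4)[of False] by (auto simp: distinct_map inj_on_def)
    moreover have "edge_lengths ?T = edge_lengths (?S False)"
      by (rule edge_lengths_map) (auto simp: S(2) intro!: linear_length_reflect
          simp del: mult_Suc_right)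
    moreover have "hd ?T = y"
      using p_simps S(1)[of False] by (simp add: hd_map hd_snake)
    moreover have "?T \<noteq> []" "length ?T = ?N"
      using S(1,3)[of False] by auto
    ultimately have "standard_linear_realization
        (replicate_mset a 1 + replicate_mset b x + replicate_mset c y) (0 # ?T)"
      unfolding standard_linear_realization_iff
      using S(5)[of False] 2 by (auto simp add: edge_lengths_Cons simp del: mult_Suc_right)
    then show ?thesis by blast
  qed
qed

end
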